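(* Let $\alpha \in [0,1]$ and $H \in (0,1)$, and let $X^{\alpha,H} = \{X^{\alpha,H}_{(x_1,x_2)}\}_{(x_1,x_2)\in\mathbb{R}^2}$ be the weighted tensorized fractional Brownian field with parameters $\alpha, H$. Then $X^{\alpha,H}$ is self-similar in the following sense: for all $a>0$, $$\{X^{\alpha,H}_{(a x_1, a x_2)}\}_{(x_1,x_2)\in \mathbb{R}^2}\stackrel{(d)}{=}\{a^{2H} X^{\alpha,H}_{(x_1, x_2)}\}_{(x_1,x_2)\in \mathbb{R}^2}.$$
   Context: For $\alpha\in[0,1]$ and $H\in(0,1)$ set $H_\alpha^+ := (1+\alpha)H$ and $H_\alpha^- := (1-\alpha)H$, and $$\phi_{\alpha,H}(\xi_1,\xi_2) := \min(|\xi_1|,|\xi_2|)^{H_\alpha^-+\frac12}\,\max(|\xi_1|,|\xi_2|)^{H_\alpha^++\frac12}.$$ The weighted tensorized fractional Brownian field $X^{\alpha,H}$ is the Gaussian field $$X^{\alpha,H}_{(x_1,x_2)} := \int_{\mathbb{R}^2} \mathcal{K}^{\alpha,H}_{(x_1,x_2)}(\xi_1,\xi_2)\, d\hat{\mathbf{W}}(\boldsymbol{\xi}), \qquad \mathcal{K}^{\alpha,H}_{(x_1,x_2)}(\xi_1,\xi_2) := \frac{(e^{i x_1\xi_1}-1)(e^{i x_2\xi_2}-1)}{\phi_{\alpha,H}(\xi_1,\xi_2)}.$$ For each $(x_1,x_2)$ the kernel belongs to $L^2(\mathbb{R}^2)$. Here $d\hat{\mathbf{W}}$ is the Fourier transform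 of real Gaussian white noise on $\mathbb{R}^2$: the map $f\mapsto\int f\,d\hat{\mathbf{W}}$ is linear, satisfies the isometry $\mathbb{E}\left[\int f\,d\hat{\mathbf{W}}\;\overline{\int g\,d\hat{\mathbf{W}}}\right]=\int_{\mathbb{R}^2} f\,\overline{g}\,d\boldsymbol{\xi}$, and yields jointly Gaussian, centered, real-valued variables for those $f\in L^2(\mathbb{R}^2)$ with $f(-\boldsymbol{\xi})=\overline{f(\boldsymbol{\xi})}$ (as is the case for the kernels above). Equivalently, $X^{\alpha,H}$ is a centered real Gaussian field with covariance $\mathbb{E}[X^{\alpha,H}_{x}X^{\alpha,H}_{y}]=\int_{\mathbb{R}^2}\mathcal{K}^{\alpha,H}_{x}(\boldsymbol{\xi})\,\overline{\mathcal{K}^{\alpha,H}_{y}(\boldsymbol{\xi})}\,d\boldsymbol{\xi}$. The symbol $\stackrel{(d)}{=}$ denotes equality of all finite-dimensional distributions. *)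

theory Defs
  imports "HOL-Probability.Probability"
begin

definition square_integrable :: "'a measure \<Rightarrow> ('a \<Rightarrow> complex) \<Rightarrow> bool" where
  "square_integrable M f \<longleftrightarrow>
     f \<in> borel_measurable M \<and> integrable M (\<lambda>x. (cmod (f x))\<^sup>2)"

definition hermitian :: "(real \<times> real \<Rightarrow> complex) \<Rightarrow> bool" where
  "hermitian f \<longleftrightarrow> (AE \<xi> in lborel. f (- \<xi>) = cnj (f \<xi>))"

text \<open>Constants count as (degenerate) Gaussian variables; this is needed for joint
  Gaussianity, since a nontrivial linear combination may have variance zero.\<close>

definition gaussian_rv :: "'w measure \<Rightarrow> ('w \<Rightarrow> real) \<Rightarrow> bool" where
  "gaussian_rv M X \<longleftrightarrow> X \<in> borel_measurable M \<and>
     (\<exists>\<mu>. (AE \<omega> in M. X \<omega> = \<mu>) \<or>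
          (\<exists>\<sigma>>0. distributed M lborel X (\<lambda>t. ennreal (normal_density \<mu> \<sigma> t))))"

definition jointly_gaussian :: "'w measure \<Rightarrow> 'i set \<Rightarrow> ('i \<Rightarrow> 'w \<Rightarrow> real) \<Rightarrow> bool" where
  "jointly_gaussian M I X \<longleftrightarrow>
     (\<forall>J c. finite J \<and> J \<subseteq> I \<longrightarrow> gaussian_rv M (\<lambda>\<omega>. \<Sum>i\<in>J. c i * X i \<omega>))"

text \<open>The map \<open>f \<mapsto> \<integral> f dW\<close> on complex square-integrable functions on the plane, where
  \<open>W\<close> is the Fourier transform of real Gaussian white noise. Random variables are
  identified almost surely, so linearity and real-valuedness are almost sure statements.
  Nothing is assumed about \<open>W f\<close> when \<open>f\<close> is not square-integrable.\<close>

locale fourier_white_noise = prob_space M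
  for M :: "'w measure" +
  fixes W :: "(real \<times> real \<Rightarrow> complex) \<Rightarrow> 'w \<Rightarrow> complex"
  assumes square_integrable_W:
      "square_integrable lborel f \<Longrightarrow> square_integrable M (W f)"
    and linear_W:
      "square_integrable lborel f \<Longrightarrow> square_integrable lborel g \<Longrightarrow>
         AE \<omega> in M. W (\<lambda>\<xi>. c * f \<xi> + d * g \<xi>) \<omega> = c * W f \<omega> + d * W g \<omega>"
    and isometry_W:
      "square_integrable lborel f \<Longrightarrow> square_integrable lborel g \<Longrightarrow>
         (\<integral>\<omega>. W f \<omega> * cnj (W g \<omega>) \<partial>M) = (\<integral>\<xi>. f \<xi> * cnj (g \<xi>) \<partial>lborel)"
    and real_W:
      "square_integrable lborel f \<Longrightarrow> hermitian f \<Longrightarrow> AE \<omega> in M. W f \<omega> \<in> \<real>"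
    and centered_W:
      "square_integrable lborel f \<Longrightarrow> hermitian f \<Longrightarrow> (\<integral>\<omega>. W f \<omega> \<partial>M) = 0"
    and jointly_gaussian_W:
      "jointly_gaussian M {f. square_integrable lborel f \<and> hermitian f} (\<lambda>f \<omega>. Re (W f \<omega>))"

definition H_plus :: "real \<Rightarrow> real \<Rightarrow> real" where
  "H_plus \<alpha> H = (1 + \<alpha>) * H"

definition H_minus :: "real \<Rightarrow> real \<Rightarrow> real" where
  "H_minus \<alpha> H = (1 - \<alpha>) * H"

definition wt_phi :: "real \<Rightarrow> real \<Rightarrow> real \<times> real \<Rightarrow> real" where
  "wt_phi \<alpha> H = (\<lambda>(\<xi>1, \<xi>2).
     min \<bar>\<xi>1\<bar> \<bar>\<xi>2\<bar> powr (H_minus \<alpha> H + 1/2) * max \<bar>\<xi>1\<bar> \<bar>\<xi>2\<bar> powr (H_plus \<alpha> H + 1/2))"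

text \<open>On the coordinate axes, a null set, \<open>wt_phi\<close> vanishes and the quotient is zero by convention.\<close>

definition wt_kernel :: "real \<Rightarrow> real \<Rightarrow> real \<times> real \<Rightarrow> real \<times> real \<Rightarrow> complex" where
  "wt_kernel \<alpha> H = (\<lambda>(x1, x2) (\<xi>1, \<xi>2).
     (exp (\<i> * complex_of_real (x1 * \<xi>1)) - 1) * (exp (\<i> * complex_of_real (x2 * \<xi>2)) - 1)
       / complex_of_real (wt_phi \<alpha> H (\<xi>1, \<xi>2)))"

text \<open>The kernels are Hermitian, so the integral is almost surely real; \<open>Re\<close> only
  turns it into a field of type \<open>real\<close>.\<close>

definition weighted_tensorized_fbf ::
  "((real \<times> real \<Rightarrow> complex) \<Rightarrow> 'w \<Rightarrow> complex) \<Rightarrow> real \<Rightarrow> real \<Rightarrow> real \<times> real \<Rightarrow> 'w \<Rightarrow> real" where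
  "weighted_tensorized_fbf W \<alpha> H x \<omega> = Re (W (wt_kernel \<alpha> H x) \<omega>)"

text \<open>Measurability is required explicitly because \<open>distr\<close> is not meaningful for
  non-measurable maps.\<close>

definition equal_fdd ::
  "'v measure \<Rightarrow> ('i \<Rightarrow> 'v \<Rightarrow> real) \<Rightarrow> 'w measure \<Rightarrow> ('i \<Rightarrow> 'w \<Rightarrow> real) \<Rightarrow> bool" where
  "equal_fdd M X N Y \<longleftrightarrow>
     (\<forall>i. X i \<in> borel_measurable M) \<and> (\<forall>i. Y i \<in> borel_measurable N) \<and>
     (\<forall>J. finite J \<longrightarrow>
        distr M (PiM J (\<lambda>_. borel)) (\<lambda>\<omega>. \<lambda>i\<in>J. X i \<omega>) =
        distr N (PiM J (\<lambda>_. borel)) (\<lambda>\<omega>. \<lambda>i\<in>J. Y i \<omega>))"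

end

theory Submission
  imports Defs
begin

text \<open>The kernel satisfies \<open>K (a x) \<xi> = a powr (2 H + 1) * K x (a \<xi>)\<close>, because \<open>wt_phi\<close> is
  homogeneous of degree \<open>2 H + 1\<close>. Substituting \<open>\<xi> \<mapsto> a \<xi>\<close> in the plane costs a factor
  \<open>a powr (-2)\<close>, so corresponding linear combinations of the two fields are integrals of
  Hermitian functions of equal \<open>L\<^sup>2\<close> norm, that is, centered Gaussian variables of equal
  variance. By the Cramer-Wold device the finite-dimensional distributions agree.\<close>

section \<open>The Cramer-Wold device\<close>

text \<open>As \<open>sin z = cos (z - pi / 2)\<close>, the real and imaginary parts of the
  characteristic function both belong to the single family of integrals of
  \<open>w x * cos (t * U x + b)\<close>. Knowing that family for all \<open>t\<close> and
  \<open>b\<close> therefore determines the characteristic function.\<close>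

lemma char_distr_density:
  fixes U :: "'a \<Rightarrow> real" and w :: "'a \<Rightarrow> real"
  assumes [measurable]: "U \<in> borel_measurable M"
    and w: "integrable M w" "\<And>x. 0 \<le> w x"
  shows "char (distr (density M (\<lambda>x. ennreal (w x))) borel U) t =
    Complex (\<integral>x. w x * cos (t * U x + 0) \<partial>M) (\<integral>x. w x * cos (t * U x + - (pi / 2)) \<partial>M)"
proof -
  have [measurable]: "w \<in> borel_measurable M"
    using w by auto
  have "integrable M (\<lambda>x. w x *\<^sub>R iexp (t * U x))"
    by (rule Bochner_Integration.integrable_bound[OF w(1)]) auto
  then have "Complex (\<integral>x. w x * cos (t * U x) \<partial>M) (\<integral>x. w x * sin (t * U x) \<partial>M) =
    (\<integral>x. w x *\<^sub>R iexp (t * U x) \<partial>M)"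
    by (intro complex_eqI) (auto simp flip: integral_Re integral_Im simp: Re_exp Im_exp)
  moreover have "cos (z + - (pi / 2)) = sin z" for z :: real
    by (simp add: cos_diff)
  ultimately show ?thesis
    using w(2) by (simp add: char_def integral_distr integral_density)
qed

text \<open>Levy's uniqueness theorem, carried over from probability measures to finite ones. The
  case \<open>u = b = 0\<close> shows that both weights have the same total mass \<open>c\<close>,
  and dividing by \<open>c\<close> turns them into probability densities.\<close>

lemma weighted_law_eqI:
  fixes U :: "'a \<Rightarrow> real" and V :: "'b \<Rightarrow> real"
  assumes U[measurable]: "U \<in> borel_measurable M" and V[measurable]: "V \<in> borel_measurable N"
    and w: "integrable M w" "\<And>x. 0 \<le> w x" and w': "integrable N w'" "\<And>y. 0 \<le> w' y"
    and eq: "\<And>u b. (\<integral>x. w x * cos (u * U x + b) \<partial>M) = (\<integral>y. w' y * cos (u * V y + b) \<partial>N)"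
    and A[measurable]: "A \<in> sets borel"
  shows "(\<integral>x. w x * indicator A (U x) \<partial>M) = (\<integral>y. w' y * indicator A (V y) \<partial>N)"
proof -
  have [measurable]: "w \<in> borel_measurable M" "w' \<in> borel_measurable N"
    using w w' by auto
  define c where "c = (\<integral>x. w x \<partial>M)"
  have c': "c = (\<integral>y. w' y \<partial>N)"
    using eq[of 0 0] by (simp add: c_def)
  have "0 \<le> c"
    unfolding c_def by (simp add: w)
  show ?thesis
  \<comment> \<open>Mass zero cannot be normalised, but then both weights vanish almost
    everywhere.\<close>
  proof (cases "c = 0")
    case True
    then have "AE x in M. w x = 0" "AE y in N. w' y = 0"
      using integral_nonneg_eq_0_iff_AE[OF w(1)] integral_nonneg_eq_0_iff_AE[OF w'(1)] w w' c' c_def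
      by auto
    then have "(\<integral>x. w x * indicator A (U x) \<partial>M) = 0" "(\<integral>y. w' y * indicator A (V y) \<partial>N) = 0"
      by (auto intro!: integral_eq_zero_AE)
    then show ?thesis by simp
  next
    case False
    with \<open>0 \<le> c\<close> have "0 < c" by simp
    let ?P = "density M (\<lambda>x. ennreal (w x / c))" and ?Q = "density N (\<lambda>y. ennreal (w' y / c))"
    have "prob_space ?P" "prob_space ?Q"
      using w w' \<open>0 < c\<close>
      by (auto intro!: prob_spaceI simp: emeasure_density nn_integral_eq_integral
          simp flip: c_def c')
    then have rd: "real_distribution (distr ?P borel U)" "real_distribution (distr ?Q borel V)"
      by (auto intro!: prob_space.real_distribution_distr)
    have "char (distr ?P borel U) t = char (distr ?Q borel V) t" for t
    proof -
      have "char (distr ?P borel U) t = Complex (\<integral>x. w x / c * cos (t * U x + 0) \<partial>M)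
          (\<integral>x. w x / c * cos (t * U x + - (pi / 2)) \<partial>M)"
        using w \<open>0 < c\<close> by (intro char_distr_density) auto
      moreover have "char (distr ?Q borel V) t = Complex (\<integral>y. w' y / c * cos (t * V y + 0) \<partial>N)
          (\<integral>y. w' y / c * cos (t * V y + - (pi / 2)) \<partial>N)"
        using w' \<open>0 < c\<close> by (intro char_distr_density) auto
      moreover have "(\<integral>x. w x / c * cos (t * U x + b) \<partial>M) = (\<integral>y. w' y / c * cos (t * V y + b) \<partial>N)"
        for b using eq[of t b] by simp
      ultimately show ?thesis by (simp only:)
    qed
    then have PQ: "distr ?P borel U = distr ?Q borel V"
      by (intro Levy_uniqueness rd ext)
    have "(\<integral>x. indicator A x \<partial>distr ?P borel U) = (\<integral>x. w x * indicator A (U x) \<partial>M) / c"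
      using w \<open>0 < c\<close> by (subst integral_distr) (auto simp: integral_density)
    moreover have "(\<integral>y. indicator A y \<partial>distr ?Q borel V) = (\<integral>y. w' y * indicator A (V y) \<partial>N) / c"
      using w' \<open>0 < c\<close> by (subst integral_distr) (auto simp: integral_density)
    ultimately show ?thesis
      using PQ \<open>0 < c\<close> by simp
  qed
qed

text \<open>The coordinates in \<open>I\<close> have already been localised to the sets \<open>A i\<close>, the others are still
  only seen through the characteristic function; \<open>I = J\<close> gives the probabilities of boxes.\<close>

lemma box_cos_integral_eq:
  fixes X :: "'i \<Rightarrow> 'a \<Rightarrow> real" and Y :: "'i \<Rightarrow> 'b \<Rightarrow> real"
  assumes "prob_space M" "prob_space N"
    and X[measurable]: "\<And>i. X i \<in> borel_measurable M"
    and Y[measurable]: "\<And>i. Y i \<in> borel_measurable N"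
    and J: "finite J" "I \<subseteq> J"
    and A[measurable]: "\<And>i. A i \<in> sets borel"
    and lin: "\<And>t. distr M borel (\<lambda>x. \<Sum>i\<in>J. t i * X i x) = distr N borel (\<lambda>y. \<Sum>i\<in>J. t i * Y i y)"
  shows "(\<integral>x. (\<Prod>i\<in>I. indicator (A i) (X i x)) * cos ((\<Sum>i\<in>J - I. t i * X i x) + b) \<partial>M) =
         (\<integral>y. (\<Prod>i\<in>I. indicator (A i) (Y i y)) * cos ((\<Sum>i\<in>J - I. t i * Y i y) + b) \<partial>N)"
  using finite_subset[OF J(2,1)] J(2)
proof (induction I arbitrary: t b rule: finite_induct)
  case empty
  \<comment> \<open>With nothing localised, the integrand is a function of the full linear
    combination, whose law \<open>lin\<close> controls.\<close>
  have "(\<integral>z. cos (z + b) \<partial>distr M borel (\<lambda>x. \<Sum>i\<in>J. t i * X i x)) =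
        (\<integral>z. cos (z + b) \<partial>distr N borel (\<lambda>y. \<Sum>i\<in>J. t i * Y i y))"
    by (simp add: lin)
  then show ?case by (simp add: integral_distr)
next
  case (insert k I)
  interpret M: prob_space M by fact
  interpret N: prob_space N by fact
  let ?L = "J - insert k I"
  define wX wY SX SY where "wX x = (\<Prod>i\<in>I. indicator (A i) (X i x) :: real)"
    and "wY y = (\<Prod>i\<in>I. indicator (A i) (Y i y) :: real)"
    and "SX x = (\<Sum>i\<in>?L. t i * X i x)" and "SY y = (\<Sum>i\<in>?L. t i * Y i y)" for x y
  have [measurable]: "wX \<in> borel_measurable M" "wY \<in> borel_measurable N"
    "SX \<in> borel_measurable M" "SY \<in> borel_measurable N"
    unfolding wX_def wY_def SX_def SY_def by measurable
  have wX: "0 \<le> wX x" "wX x \<le> 1" and wY: "0 \<le> wY y" "wY y \<le> 1" for x y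
    unfolding wX_def wY_def by (auto intro!: prod_nonneg prod_le_1)
  have intX: "integrable M (\<lambda>x. wX x * f x)"
    if "f \<in> borel_measurable M" "\<And>x. \<bar>f x\<bar> \<le> 1" for f :: "'a \<Rightarrow> real"
    using that wX by (intro M.integrable_const_bound[of _ 1]) (auto simp: abs_mult intro!: mult_le_one)
  have intY: "integrable N (\<lambda>x. wY x * f x)"
    if "f \<in> borel_measurable N" "\<And>x. \<bar>f x\<bar> \<le> 1" for f :: "'b \<Rightarrow> real"
    using that wY by (intro N.integrable_const_bound[of _ 1]) (auto simp: abs_mult intro!: mult_le_one)
  have split: "J - I = insert k ?L" and "finite ?L" "k \<notin> ?L"
    using insert J by auto
  \<comment> \<open>Coordinate \<open>k\<close> gets its own frequency \<open>u\<close>, as needed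
    to localise it. The common factor \<open>s\<close> on the other frequencies stays free: 0
    removes them, and 1 and -1 occur in the product formula \<open>pf\<close>.\<close>
  have IH: "(\<integral>x. wX x * cos (u * X k x + s * SX x + b) \<partial>M) =
      (\<integral>y. wY y * cos (u * Y k y + s * SY y + b) \<partial>N)" for u s b
  proof -
    let ?t = "\<lambda>i. if i = k then u else s * t i"
    have "(\<Sum>i\<in>J - I. ?t i * X i x) = u * X k x + s * SX x"
      "(\<Sum>i\<in>J - I. ?t i * Y i y) = u * Y k y + s * SY y" for x y
      unfolding split SX_def SY_def sum.insert[OF \<open>finite ?L\<close> \<open>k \<notin> ?L\<close>] sum_distrib_left
      using \<open>k \<notin> ?L\<close> by (auto intro!: sum.cong)
    with insert.IH[of ?t b] insert.prems show ?thesis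
      by (simp add: wX_def wY_def)
  qed
  have plain: "(\<integral>x. wX x * indicator (A k) (X k x) \<partial>M) = (\<integral>y. wY y * indicator (A k) (Y k y) \<partial>N)"
    using IH[of _ 0] intX[of "\<lambda>_. 1"] intY[of "\<lambda>_. 1"] wX wY
    by (intro weighted_law_eqI) auto
  \<comment> \<open>Adding 1 makes the weight nonnegative, so that it defines a measure;
    \<open>plain\<close> removes the 1 afterwards.\<close>
  have "(\<integral>x. (wX x * (1 + cos (SX x + b))) * indicator (A k) (X k x) \<partial>M) =
    (\<integral>y. (wY y * (1 + cos (SY y + b))) * indicator (A k) (Y k y) \<partial>N)"
  proof (rule weighted_law_eqI)
    have "- 1 \<le> cos z" for z :: real by simp
    then have "0 \<le> 1 + cos z" for z :: real by (metis add.commute diff_ge_0_iff_ge diff_minus_eq_add)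
    then show "0 \<le> wX x * (1 + cos (SX x + b))" "0 \<le> wY y * (1 + cos (SY y + b))" for x y
      using wX wY by auto
    show "integrable M (\<lambda>x. wX x * (1 + cos (SX x + b)))"
      "integrable N (\<lambda>y. wY y * (1 + cos (SY y + b)))"
      using intX[of "\<lambda>_. 1"] intX[of "\<lambda>x. cos (SX x + b)"] intY[of "\<lambda>_. 1"] intY[of "\<lambda>x. cos (SY x + b)"]
      by (simp_all add: distrib_left)
    \<comment> \<open>The product of the two cosines is split by the product-to-sum formula. The
      three resulting terms are written literally as instances of \<open>IH\<close> with
      \<open>s\<close> equal to 0, 1 and -1, hence the formal factors in front of
      \<open>S\<close>.\<close>
    have pf: "w * (1 + cos (S + b)) * cos (z + b') = w * cos (z + 0 * S + b')
        + (w * cos (z + 1 * S + (b' + b)) + w * cos (z + (- 1) * S + (b' - b))) / 2"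
      for w S z b' :: real
    proof -
      have "cos (z + b' + (S + b)) + cos (z + b' - (S + b)) = 2 * cos (z + b') * cos (S + b)"
        by (simp add: cos_add cos_diff)
      moreover have "z + 1 * S + (b' + b) = z + b' + (S + b)" "z + (- 1) * S + (b' - b) = z + b' - (S + b)"
        by simp_all
      ultimately have "cos (z + 1 * S + (b' + b)) + cos (z + (- 1) * S + (b' - b)) = 2 * cos (z + b') * cos (S + b)"
        by (simp only:)
      then have "w * cos (z + 1 * S + (b' + b)) + w * cos (z + (- 1) * S + (b' - b)) =
          w * (2 * cos (z + b') * cos (S + b))"
        by (simp only: flip: distrib_left)
      then show ?thesis
        by (simp only:) (simp add: distrib_left distrib_right mult_ac)
    qed
    show "(\<integral>x. wX x * (1 + cos (SX x + b)) * cos (u * X k x + b') \<partial>M) =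
      (\<integral>y. wY y * (1 + cos (SY y + b)) * cos (u * Y k y + b') \<partial>N)" for u b'
      unfolding pf using IH[of u 0 b'] IH[of u 1 "b' + b"] IH[of u "-1" "b' - b"]
      by (simp add: intX intY)
  qed auto
  then have "(\<integral>x. wX x * (indicator (A k) (X k x) * cos (SX x + b)) \<partial>M) =
    (\<integral>y. wY y * (indicator (A k) (Y k y) * cos (SY y + b)) \<partial>N)"
    using plain intX[of "\<lambda>x. indicator (A k) (X k x)"] intY[of "\<lambda>y. indicator (A k) (Y k y)"]
      intX[of "\<lambda>x. indicator (A k) (X k x) * cos (SX x + b)"]
      intY[of "\<lambda>y. indicator (A k) (Y k y) * cos (SY y + b)"]
    by (simp add: algebra_simps abs_mult mult_le_one)
  then show ?case
    using insert by (simp add: wX_def wY_def SX_def SY_def mult_ac)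
qed

text \<open>Puts box probabilities into the shape that \<open>box_cos_integral_eq\<close> yields for
  \<open>I = J\<close>.\<close>

lemma emeasure_distr_PiE:
  fixes X :: "'i \<Rightarrow> 'a \<Rightarrow> real"
  assumes "prob_space M" and J: "finite J"
    and [measurable]: "\<And>i. X i \<in> borel_measurable M" "\<And>i. A i \<in> sets borel"
  shows "emeasure (distr M (PiM J (\<lambda>_. borel)) (\<lambda>x. \<lambda>i\<in>J. X i x)) (Pi\<^sub>E J A) =
      ennreal (\<integral>x. (\<Prod>i\<in>J. indicator (A i) (X i x)) \<partial>M)"
proof -
  interpret prob_space M by fact
  have "(\<integral>x. (\<Prod>i\<in>J. indicator (A i) (X i x)) \<partial>M :: real) =
    (\<integral>x. indicator {x \<in> space M. \<forall>i\<in>J. X i x \<in> A i} x \<partial>M)"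
    using J by (intro Bochner_Integration.integral_cong) (auto simp: indicator_def)
  also have "\<dots> = measure M {x \<in> space M. \<forall>i\<in>J. X i x \<in> A i}"
    using J by simp
  also have "{x \<in> space M. \<forall>i\<in>J. X i x \<in> A i} = (\<lambda>x. \<lambda>i\<in>J. X i x) -` Pi\<^sub>E J A \<inter> space M"
    by auto
  finally show ?thesis
    using J by (subst emeasure_distr) (auto simp: emeasure_eq_measure)
qed

text \<open>Boxes form an intersection-stable generator of the product sigma-algebra, so finite
  measures that agree on all boxes coincide. Agreement on boxes is the fully localised case of
  \<open>box_cos_integral_eq\<close>.\<close>

theorem cramer_wold:
  fixes X :: "'i \<Rightarrow> 'a \<Rightarrow> real" and Y :: "'i \<Rightarrow> 'b \<Rightarrow> real"
  assumes "prob_space M" "prob_space N"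
    and X[measurable]: "\<And>i. X i \<in> borel_measurable M"
    and Y[measurable]: "\<And>i. Y i \<in> borel_measurable N"
    and J: "finite J"
    and lin: "\<And>t. distr M borel (\<lambda>x. \<Sum>i\<in>J. t i * X i x) = distr N borel (\<lambda>y. \<Sum>i\<in>J. t i * Y i y)"
  shows "distr M (PiM J (\<lambda>_. borel)) (\<lambda>x. \<lambda>i\<in>J. X i x) =
         distr N (PiM J (\<lambda>_. borel)) (\<lambda>y. \<lambda>i\<in>J. Y i y)"
proof (rule measure_eqI_PiM_finite[where A = "\<lambda>_. Pi\<^sub>E J (\<lambda>_. UNIV)", OF J])
  interpret M: prob_space M by fact
  interpret N: prob_space N by fact
  show "emeasure (distr M (PiM J (\<lambda>_. borel)) (\<lambda>x. \<lambda>i\<in>J. X i x)) (Pi\<^sub>E J A) =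
    emeasure (distr N (PiM J (\<lambda>_. borel)) (\<lambda>y. \<lambda>i\<in>J. Y i y)) (Pi\<^sub>E J A)"
    if "\<And>i. i \<in> J \<Longrightarrow> A i \<in> sets borel" for A
  proof -
    \<comment> \<open>A Borel set is required at every index, while \<open>A\<close> is controlled
      only on \<open>J\<close>; values off \<open>J\<close> do not affect
      \<open>Pi\<^sub>E J A\<close>.\<close>
    let ?A = "\<lambda>i. if i \<in> J then A i else {}"
    have A: "?A i \<in> sets borel" for i using that by auto
    \<comment> \<open>The sum over \<open>J - J\<close> is empty and the phase is 0, so the cosine
      equals 1.\<close>
    have "(\<integral>x. (\<Prod>i\<in>J. indicator (?A i) (X i x)) * cos ((\<Sum>i\<in>J - J. 0 * X i x) + 0) \<partial>M) =
         (\<integral>y. (\<Prod>i\<in>J. indicator (?A i) (Y i y)) * cos ((\<Sum>i\<in>J - J. 0 * Y i y) + 0) \<partial>N)"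
      by (rule box_cos_integral_eq[OF assms(1,2) X Y J order.refl A lin])
    moreover have "Pi\<^sub>E J ?A = Pi\<^sub>E J A" by (rule PiE_cong) simp
    ultimately show ?thesis
      using emeasure_distr_PiE[where X = X and A = ?A, OF assms(1) J X A]
        emeasure_distr_PiE[where X = Y and A = ?A, OF assms(2) J Y A] by simp
  qed
  show "range (\<lambda>_::nat. Pi\<^sub>E J (\<lambda>_. UNIV)) \<subseteq> prod_algebra J (\<lambda>_. borel :: real measure)"
    using J by (auto intro!: prod_algebraI_finite)
  show "(\<Union>_::nat. Pi\<^sub>E J (\<lambda>_. UNIV :: real set)) = space (PiM J (\<lambda>_. borel))"
    by (simp add: space_PiM)
  show "emeasure (distr M (PiM J (\<lambda>_. borel)) (\<lambda>x. \<lambda>i\<in>J. X i x)) (Pi\<^sub>E J (\<lambda>_. UNIV)) \<noteq> \<infinity>" for i :: nat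
    using emeasure_distr_PiE[where X = X and A = "\<lambda>_. UNIV", OF assms(1) J X] by simp
qed auto

section \<open>Gaussian variables and white noise integrals\<close>

text \<open>The parameters hidden in \<open>gaussian_rv\<close> can be recovered from the first two
  moments, and they fix the law.\<close>

lemma gaussian_rv_distr_eqI:
  assumes "prob_space M" "prob_space N" and "gaussian_rv M X" "gaussian_rv N Y"
    and mean: "(\<integral>x. X x \<partial>M) = (\<integral>y. Y y \<partial>N)"
    and second: "(\<integral>x. (X x)\<^sup>2 \<partial>M) = (\<integral>y. (Y y)\<^sup>2 \<partial>N)"
  shows "distr M borel X = distr N borel Y"
proof -
  \<comment> \<open>The value 0 of \<sigma> encodes the degenerate case, where the law is a point
    mass. Nonnegativity makes \<sigma> determined by its square, the variance.\<close>
  have law: "\<exists>\<sigma>\<ge>0. \<sigma>\<^sup>2 = (\<integral>x. (Z x)\<^sup>2 \<partial>P) - (\<integral>x. Z x \<partial>P)\<^sup>2 \<and>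
      distr P borel Z = (if \<sigma> = 0 then return borel (\<integral>x. Z x \<partial>P)
        else density lborel (normal_density (\<integral>x. Z x \<partial>P) \<sigma>))"
    if "prob_space P" "gaussian_rv P Z" for P :: "'c measure" and Z
  proof -
    interpret P: prob_space P by fact
    from that obtain \<mu> where [measurable]: "Z \<in> borel_measurable P"
      and "(AE \<omega> in P. Z \<omega> = \<mu>) \<or>
        (\<exists>\<sigma>>0. distributed P lborel Z (\<lambda>t. ennreal (normal_density \<mu> \<sigma> t)))"
      unfolding gaussian_rv_def by auto
    then consider "AE \<omega> in P. Z \<omega> = \<mu>"
      | \<sigma> where "0 < \<sigma>" "distributed P lborel Z (\<lambda>t. ennreal (normal_density \<mu> \<sigma> t))"
      by auto
    then show ?thesis
    proof cases
      case 1
      have "(\<integral>x. Z x \<partial>P) = (\<integral>x. \<mu> \<partial>P)" "(\<integral>x. (Z x)\<^sup>2 \<partial>P) = (\<integral>x. \<mu>\<^sup>2 \<partial>P)"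
        by (rule integral_cong_AE; use 1 in auto)+
      moreover have "distr P borel Z = distr P borel (\<lambda>_. \<mu>)"
        using 1 by (intro distr_cong_AE) auto
      ultimately show ?thesis
        by (intro exI[of _ 0]) (simp add: P.prob_space P.distr_const)
    next
      case 2
      have E: "(\<integral>x. Z x \<partial>P) = \<mu>"
        using 2 by (rule P.normal_distributed_expectation)
      have V: "P.variance Z = \<sigma>\<^sup>2"
        using 2 by (rule P.normal_distributed_variance)
      have "integrable lborel (\<lambda>x. normal_density \<mu> \<sigma> x * (x - \<mu>)^2)"
        using integrable_normal_moment[OF \<open>0 < \<sigma>\<close>] .
      then have "integrable P (\<lambda>x. (Z x - \<mu>)\<^sup>2)"
        using distributed_integrable[OF 2(2), of "\<lambda>z. (z - \<mu>)\<^sup>2"] by simp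
      moreover have "integrable lborel (\<lambda>x. normal_density \<mu> \<sigma> x * x)"
        using integrable_normal_moment_nz_1[OF \<open>0 < \<sigma>\<close>] .
      then have i1: "integrable P Z"
        using distributed_integrable[OF 2(2), of "\<lambda>z. z"] by simp
      \<comment> \<open>The sum is the square of \<open>Z x\<close>, whose integrability is required
        to write the variance as second moment minus squared mean.\<close>
      ultimately have "integrable P (\<lambda>x. (Z x - \<mu>)\<^sup>2 + (2 * \<mu> * Z x - \<mu>\<^sup>2))"
        by auto
      then have "integrable P (\<lambda>x. (Z x)\<^sup>2)"
        by (simp add: power2_eq_square algebra_simps)
      then have "\<sigma>\<^sup>2 = (\<integral>x. (Z x)\<^sup>2 \<partial>P) - \<mu>\<^sup>2"
        using P.variance_eq[OF i1] V E by simp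
      moreover have "distr P borel Z = distr P lborel Z"
        by (rule distr_cong) auto
      ultimately show ?thesis
        using 2 E by (intro exI[of _ \<sigma>]) (simp add: distributed_def)
    qed
  qed
  obtain \<sigma> \<tau> where \<sigma>: "0 \<le> \<sigma>" "\<sigma>\<^sup>2 = (\<integral>x. (X x)\<^sup>2 \<partial>M) - (\<integral>x. X x \<partial>M)\<^sup>2"
      "distr M borel X = (if \<sigma> = 0 then return borel (\<integral>x. X x \<partial>M)
        else density lborel (normal_density (\<integral>x. X x \<partial>M) \<sigma>))"
    and \<tau>: "0 \<le> \<tau>" "\<tau>\<^sup>2 = (\<integral>x. (Y x)\<^sup>2 \<partial>N) - (\<integral>x. Y x \<partial>N)\<^sup>2"
      "distr N borel Y = (if \<tau> = 0 then return borel (\<integral>x. Y x \<partial>N)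
        else density lborel (normal_density (\<integral>x. Y x \<partial>N) \<tau>))"
    using law[OF assms(1,3)] law[OF assms(2,4)] by blast
  have "\<sigma>\<^sup>2 = \<tau>\<^sup>2"
    using \<sigma>(2) \<tau>(2) mean second by simp
  then have "\<sigma> = \<tau>"
    using \<sigma>(1) \<tau>(1) by (simp add: power2_eq_iff_nonneg)
  then show ?thesis
    using \<sigma>(3) \<tau>(3) mean by simp
qed

section \<open>Linear combinations of square-integrable and Hermitian functions\<close>

lemma square_integrable_cmult:
  assumes "square_integrable M f"
  shows "square_integrable M (\<lambda>x. c * f x)"
  using assms by (auto simp: square_integrable_def norm_mult power_mult_distrib)

lemma square_integrable_add:
  assumes "square_integrable M f" "square_integrable M g"
  shows "square_integrable M (\<lambda>x. f x + g x)"
proof -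
  have [measurable]: "f \<in> borel_measurable M" "g \<in> borel_measurable M"
    using assms by (auto simp: square_integrable_def)
  have bound: "(cmod (z + w))\<^sup>2 \<le> 2 * (cmod z)\<^sup>2 + 2 * (cmod w)\<^sup>2" for z w
  proof -
    have "(cmod (z + w))\<^sup>2 \<le> (cmod z + cmod w)\<^sup>2"
      by (intro power_mono norm_triangle_ineq) auto
    also have "\<dots> \<le> 2 * (cmod z)\<^sup>2 + 2 * (cmod w)\<^sup>2"
      using zero_le_power2[of "cmod z - cmod w"] by (simp add: power2_eq_square algebra_simps)
    finally show ?thesis .
  qed
  have "integrable M (\<lambda>x. 2 * (cmod (f x))\<^sup>2 + 2 * (cmod (g x))\<^sup>2)"
    using assms by (auto simp: square_integrable_def)
  then have "integrable M (\<lambda>x. (cmod (f x + g x))\<^sup>2)"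
    by (rule Bochner_Integration.integrable_bound) (auto simp: bound)
  then show ?thesis
    by (simp add: square_integrable_def)
qed

lemma square_integrable_lincomb:
  assumes "\<And>i. i \<in> J \<Longrightarrow> square_integrable M (f i)"
  shows "square_integrable M (\<lambda>x. \<Sum>i\<in>J. c i * f i x)"
  using assms
proof (induction J rule: infinite_finite_induct)
  case (insert k J)
  then show ?case
    by (auto intro!: square_integrable_add square_integrable_cmult)
qed (simp_all add: square_integrable_def)

text \<open>Conjugation fixes real coefficients, which is why they enter through
  \<open>complex_of_real\<close>; \<open>square_integrable_lincomb\<close> allows complex
  ones.\<close>

lemma hermitian_lincomb:
  assumes "\<And>i. i \<in> J \<Longrightarrow> hermitian (f i)"
  shows "hermitian (\<lambda>x. \<Sum>i\<in>J. complex_of_real (c i) * f i x)"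
  using assms
proof (induction J rule: infinite_finite_induct)
  case (insert k J)
  then have "AE x in lborel. f k (- x) = cnj (f k x)"
    and "AE x in lborel. (\<Sum>i\<in>J. complex_of_real (c i) * f i (- x)) =
      cnj (\<Sum>i\<in>J. complex_of_real (c i) * f i x)"
    by (auto simp: hermitian_def)
  then show ?case
    unfolding hermitian_def by eventually_elim (use insert in auto)
qed (simp_all add: hermitian_def)

section \<open>Laws of white noise integrals\<close>

context fourier_white_noise
begin

lemma W_lincomb:
  assumes "finite J" "\<And>i. i \<in> J \<Longrightarrow> square_integrable lborel (f i)"
  shows "AE \<omega> in M. W (\<lambda>\<xi>. \<Sum>i\<in>J. c i * f i \<xi>) \<omega> = (\<Sum>i\<in>J. c i * W (f i) \<omega>)"
  using assms
proof (induction J rule: finite_induct)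
  case empty
  have "square_integrable lborel (\<lambda>_::real \<times> real. 0)"
    by (simp add: square_integrable_def)
  \<comment> \<open>Linearity with both coefficients 0 makes the integral of the zero function
    vanish almost surely.\<close>
  from linear_W[OF this this, of 0 0] show ?case by simp
next
  case (insert k J)
  have "AE \<omega> in M. W (\<lambda>\<xi>. c k * f k \<xi> + 1 * (\<Sum>i\<in>J. c i * f i \<xi>)) \<omega> =
      c k * W (f k) \<omega> + 1 * W (\<lambda>\<xi>. \<Sum>i\<in>J. c i * f i \<xi>) \<omega>"
    using insert by (intro linear_W square_integrable_lincomb) auto
  moreover have "AE \<omega> in M. W (\<lambda>\<xi>. \<Sum>i\<in>J. c i * f i \<xi>) \<omega> = (\<Sum>i\<in>J. c i * W (f i) \<omega>)"
    using insert by auto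
  ultimately show ?case
    by eventually_elim (use insert in simp)
qed

lemma measurable_W:
  assumes "square_integrable lborel f"
  shows "W f \<in> borel_measurable M"
  using square_integrable_W[OF assms] by (simp add: square_integrable_def)

text \<open>For Hermitian \<open>f\<close> the variable \<open>W f\<close> is almost surely real, so
  the isometry turns the squared norm of \<open>f\<close> into the variance of a centered Gaussian
  variable. Its law thus depends on that norm alone.\<close>

lemma distr_Re_W_eqI:
  assumes f: "square_integrable lborel f" "hermitian f"
    and g: "square_integrable lborel g" "hermitian g"
    and norm: "(\<integral>\<xi>. (cmod (f \<xi>))\<^sup>2 \<partial>lborel) = (\<integral>\<xi>. (cmod (g \<xi>))\<^sup>2 \<partial>lborel)"
  shows "distr M borel (\<lambda>\<omega>. Re (W f \<omega>)) = distr M borel (\<lambda>\<omega>. Re (W g \<omega>))"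
proof -
  have gaussian: "gaussian_rv M (\<lambda>\<omega>. Re (W h \<omega>))"
    and mean: "(\<integral>\<omega>. Re (W h \<omega>) \<partial>M) = 0"
    and second: "(\<integral>\<omega>. (Re (W h \<omega>))\<^sup>2 \<partial>M) = (\<integral>\<xi>. (cmod (h \<xi>))\<^sup>2 \<partial>lborel)"
    if h: "square_integrable lborel h" "hermitian h" for h
  proof -
    show "gaussian_rv M (\<lambda>\<omega>. Re (W h \<omega>))"
      using jointly_gaussian_W[unfolded jointly_gaussian_def, rule_format, of "{h}" "\<lambda>_. 1"] h
      by simp
    note [measurable] = measurable_W[OF h(1)]
    have sq: "integrable M (\<lambda>\<omega>. (cmod (W h \<omega>))\<^sup>2)"
      using square_integrable_W[OF h(1)] by (simp add: square_integrable_def)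
    \<comment> \<open>On a probability space square integrability implies integrability, which lets
      \<open>Re\<close> pass through the expectation.\<close>
    then have "integrable M (\<lambda>\<omega>. cmod (W h \<omega>))"
      by (rule square_integrable_imp_integrable[rotated]) simp
    then have "integrable M (W h)"
      by (simp add: integrable_norm_iff)
    then show "(\<integral>\<omega>. Re (W h \<omega>) \<partial>M) = 0"
      using centered_W[OF h] by (simp add: integral_Re)
    have "complex_of_real (\<integral>\<omega>. (Re (W h \<omega>))\<^sup>2 \<partial>M) = (\<integral>\<omega>. complex_of_real ((Re (W h \<omega>))\<^sup>2) \<partial>M)"
      by (simp only: integral_complex_of_real)
    also have "\<dots> = (\<integral>\<omega>. complex_of_real ((cmod (W h \<omega>))\<^sup>2) \<partial>M)"
      using real_W[OF h] by (intro integral_cong_AE) (auto elim!: eventually_mono Reals_cases simp flip: of_real_power)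
    also have "\<dots> = (\<integral>\<omega>. W h \<omega> * cnj (W h \<omega>) \<partial>M)"
      by (simp only: complex_norm_square)
    also have "\<dots> = (\<integral>\<xi>. complex_of_real ((cmod (h \<xi>))\<^sup>2) \<partial>lborel)"
      unfolding isometry_W[OF h(1) h(1)] by (simp only: complex_norm_square)
    finally show "(\<integral>\<omega>. (Re (W h \<omega>))\<^sup>2 \<partial>M) = (\<integral>\<xi>. (cmod (h \<xi>))\<^sup>2 \<partial>lborel)"
      by (simp only: integral_complex_of_real of_real_eq_iff)
  qed
  show ?thesis
    using norm by (intro gaussian_rv_distr_eqI gaussian f g prob_space_axioms)
      (simp_all add: mean second f g)
qed

end

section \<open>The kernel\<close>

lemma lborel_integral_scaleR:
  fixes f :: "'a::euclidean_space \<Rightarrow> real"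
  assumes "c \<noteq> 0" and [measurable]: "f \<in> borel_measurable borel"
  shows "(\<integral>x. f (c *\<^sub>R x) \<partial>lborel) = (\<integral>x. f x \<partial>lborel) / \<bar>c\<bar> ^ DIM('a)"
proof -
  have "(\<integral>x. f x \<partial>lborel) = \<bar>c\<bar> ^ DIM('a) * (\<integral>x. f (c *\<^sub>R x) \<partial>lborel)"
    by (subst lborel_affine[OF assms(1), of 0]) (simp add: integral_density integral_distr)
  then show ?thesis
    using assms(1) by simp
qed

text \<open>A nonnegative gauge-integrable function is absolutely integrable, and Borel
  measurability brings it from the completed measure back to \<open>lborel\<close>. This gives
  access to the gauge integrals of real powers.\<close>

lemma set_integrable_lborel_of_integrable_on:
  fixes f :: "real \<Rightarrow> real"
  assumes "f integrable_on S" "\<And>x. x \<in> S \<Longrightarrow> 0 \<le> f x"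
    and [measurable]: "f \<in> borel_measurable borel" "S \<in> sets borel"
  shows "set_integrable lborel S f"
proof -
  have "f absolutely_integrable_on S"
    using assms by (simp add: absolutely_integrable_on_iff_nonneg)
  then show ?thesis
    unfolding set_integrable_def by (subst (asm) integrable_completion) auto
qed

text \<open>The squared modulus of the harmonizable kernel of one-dimensional fractional Brownian
  motion with Hurst parameter \<open>H\<close>.\<close>

definition fbm_weight :: "real \<Rightarrow> real \<Rightarrow> real \<Rightarrow> real" where
  "fbm_weight H x \<xi> = (cmod (exp (\<i> * complex_of_real (x * \<xi>)) - 1))\<^sup>2 / \<bar>\<xi>\<bar> powr (2 * H + 1)"

lemma fbm_weight_nonneg: "0 \<le> fbm_weight H x \<xi>"
  by (simp add: fbm_weight_def)

lemma fbm_weight_measurable [measurable]: "fbm_weight H x \<in> borel_measurable borel"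
  unfolding fbm_weight_def by measurable

text \<open>Near 0 the numerator is at most \<open>(x * \<xi>)\<^sup>2\<close>, which leaves the
  power \<open>1 - 2 * H\<close>, integrable as \<open>H < 1\<close>. Far out it is at most 4, which
  leaves the power \<open>- 2 * H - 1\<close>, integrable as \<open>0 < H\<close>.\<close>

lemma fbm_weight_integrable:
  assumes "0 < H" "H < 1"
  shows "integrable lborel (fbm_weight H x)"
proof -
  \<comment> \<open>The two bounds glued together on the positive half-line; adding the reflection
    of \<open>g\<close> covers both signs.\<close>
  define g where "g \<xi> = x\<^sup>2 * (indicator {0..1} \<xi> * \<xi> powr (1 - 2 * H)) +
    4 * (indicator {1..} \<xi> * \<xi> powr (- 2 * H - 1))" for \<xi> :: real
  have [measurable]: "g \<in> borel_measurable borel"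
    unfolding g_def by measurable
  have "set_integrable lborel {0..1} (\<lambda>\<xi>. \<xi> powr (1 - 2 * H))"
    using assms by (intro set_integrable_lborel_of_integrable_on integrable_on_powr_from_0) auto
  moreover have "set_integrable lborel {1..} (\<lambda>\<xi>. \<xi> powr (- 2 * H - 1))"
    using assms has_integral_powr_to_inf[of "- 2 * H - 1" 1]
    by (intro set_integrable_lborel_of_integrable_on) (auto simp: integrable_on_def)
  ultimately have g: "integrable lborel g"
    unfolding g_def set_integrable_def by auto
  then have g2: "integrable lborel (\<lambda>\<xi>. g \<xi> + g (- \<xi>))"
    using lborel_integrable_real_affine[of g "-1" 0] by auto
  have g0: "0 \<le> g \<xi>" for \<xi>
    unfolding g_def by auto
  have pos: "fbm_weight H x \<xi> \<le> g \<bar>\<xi>\<bar>" for \<xi>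
  proof (cases "\<xi> = 0")
    case True
    then show ?thesis using g0 by (simp add: fbm_weight_def)
  next
    case False
    \<comment> \<open>Both bounds rest on the modulus of \<open>exp (\<i> * y) - 1\<close> being
      \<open>2 * \<bar>sin (y / 2)\<bar>\<close>.\<close>
    have b1: "cmod (exp (\<i> * complex_of_real (x * \<xi>)) - 1) \<le> \<bar>x\<bar> * \<bar>\<xi>\<bar>"
      using abs_sin_x_le_abs_x[of "x * \<xi> / 2"] unfolding dist_exp_i_1 by (simp add: abs_mult)
    have b2: "cmod (exp (\<i> * complex_of_real (x * \<xi>)) - 1) \<le> 2"
      unfolding dist_exp_i_1 by simp
    show ?thesis
    proof (cases "\<bar>\<xi>\<bar> \<le> 1")
      case True
      have "fbm_weight H x \<xi> \<le> (\<bar>x\<bar> * \<bar>\<xi>\<bar>)\<^sup>2 / \<bar>\<xi>\<bar> powr (2 * H + 1)"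
        unfolding fbm_weight_def using b1 by (intro divide_right_mono power_mono) auto
      also have "\<dots> = x\<^sup>2 * (\<bar>\<xi>\<bar> powr 2 / \<bar>\<xi>\<bar> powr (2 * H + 1))"
        using False by (simp add: power_mult_distrib)
      also have "\<dots> = x\<^sup>2 * \<bar>\<xi>\<bar> powr (1 - 2 * H)"
        by (simp only: flip: powr_diff) simp
      also have "\<dots> \<le> g \<bar>\<xi>\<bar>"
        using True by (simp add: g_def)
      finally show ?thesis .
    next
      case False
      have "fbm_weight H x \<xi> \<le> 2\<^sup>2 / \<bar>\<xi>\<bar> powr (2 * H + 1)"
        unfolding fbm_weight_def using b2 by (intro divide_right_mono power_mono) auto
      also have "\<dots> = 4 * \<bar>\<xi>\<bar> powr (- 2 * H - 1)"
        using powr_minus_divide[of "\<bar>\<xi>\<bar>" "2 * H + 1"] by simp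
      also have "\<dots> \<le> g \<bar>\<xi>\<bar>"
        using False by (simp add: g_def)
      finally show ?thesis .
    qed
  qed
  have "fbm_weight H x \<xi> \<le> g \<xi> + g (- \<xi>)" for \<xi>
    using pos[of \<xi>] g0[of \<xi>] g0[of "- \<xi>"] by (cases "0 \<le> \<xi>") auto
  then show ?thesis
    by (intro Bochner_Integration.integrable_bound[OF g2]) (auto simp: fbm_weight_nonneg g0)
qed

lemma integrable_lborel_tensor:
  fixes f g :: "real \<Rightarrow> real"
  assumes "integrable lborel f" "integrable lborel g"
  shows "integrable lborel (\<lambda>\<xi>. f (fst \<xi>) * g (snd \<xi>))"
proof -
  have [measurable]: "f \<in> borel_measurable borel" "g \<in> borel_measurable borel"
    using assms by auto
  have "integrable (lborel \<Otimes>\<^sub>M lborel) (\<lambda>\<xi>. f (fst \<xi>) * g (snd \<xi>))"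
    using assms by (intro lborel_pair.Fubini_integrable) (auto simp: abs_mult)
  then show ?thesis
    by (simp add: lborel_prod)
qed

text \<open>Minimum and maximum both scale by \<open>a\<close>, and the two exponents sum to
  \<open>2 * H + 1\<close> because \<alpha> cancels.\<close>

lemma wt_phi_scaleR:
  assumes "0 < a"
  shows "wt_phi \<alpha> H (a *\<^sub>R \<xi>) = a powr (2 * H + 1) * wt_phi \<alpha> H \<xi>"
proof (cases \<xi>)
  case (Pair u v)
  have "min (abs (a * u)) (abs (a * v)) = a * min (abs u) (abs v)"
    "max (abs (a * u)) (abs (a * v)) = a * max (abs u) (abs v)"
    using assms by (auto simp: abs_mult min_def max_def)
  moreover have "a powr (H_minus \<alpha> H + 1/2) * a powr (H_plus \<alpha> H + 1/2) = a powr (2 * H + 1)"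
    by (simp add: H_minus_def H_plus_def algebra_simps flip: powr_add)
  ultimately show ?thesis
    using Pair assms by (simp add: wt_phi_def powr_mult mult_ac)
qed

text \<open>Moving the exponent \<open>\<alpha> * H\<close> from the larger to the smaller coordinate reduces square
  integrability to the one-dimensional fractional Brownian kernel.\<close>

lemma wt_phi_ge_tensor:
  assumes "0 \<le> \<alpha>" "0 < H" "u \<noteq> 0" "v \<noteq> 0"
  shows "\<bar>u\<bar> powr (H + 1/2) * \<bar>v\<bar> powr (H + 1/2) \<le> wt_phi \<alpha> H (u, v)"
proof -
  define s t where "s = min (abs u) (abs v)" and "t = max (abs u) (abs v)"
  have st: "0 < s" "s \<le> t"
    using assms by (auto simp: s_def t_def)
  have "\<bar>u\<bar> powr (H + 1/2) * \<bar>v\<bar> powr (H + 1/2) = s powr (H + 1/2) * t powr (H + 1/2)"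
    by (simp add: s_def t_def min_def max_def)
  also have "s powr (H + 1/2) = s powr (H_minus \<alpha> H + 1/2) * s powr (\<alpha> * H)"
    by (simp add: H_minus_def algebra_simps flip: powr_add)
  also have "\<dots> \<le> s powr (H_minus \<alpha> H + 1/2) * t powr (\<alpha> * H)"
    using st assms by (intro mult_left_mono powr_mono2) auto
  also have "s powr (H_minus \<alpha> H + 1/2) * t powr (\<alpha> * H) * t powr (H + 1/2) = wt_phi \<alpha> H (u, v)"
    by (simp add: wt_phi_def H_plus_def algebra_simps s_def t_def flip: powr_add)
  finally show ?thesis
    by (simp add: mult_right_mono)
qed

lemma wt_phi_measurable [measurable]: "wt_phi \<alpha> H \<in> borel_measurable borel"
  unfolding wt_phi_def case_prod_beta borel_prod[symmetric] by measurable

lemma wt_kernel_measurable [measurable]: "wt_kernel \<alpha> H x \<in> borel_measurable borel"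
  unfolding wt_kernel_def wt_phi_def case_prod_beta borel_prod[symmetric] by measurable

lemma square_integrable_wt_kernel:
  assumes "0 \<le> \<alpha>" "0 < H" "H < 1"
  shows "square_integrable lborel (wt_kernel \<alpha> H x)"
proof -
  obtain x1 x2 where x: "x = (x1, x2)" by force
  have "(cmod (wt_kernel \<alpha> H x \<xi>))\<^sup>2 \<le> fbm_weight H x1 (fst \<xi>) * fbm_weight H x2 (snd \<xi>)" for \<xi>
  proof (cases "fst \<xi> = 0 \<or> snd \<xi> = 0")
    \<comment> \<open>On the axes one exponential factor is \<open>exp 0 - 1 = 0\<close>, so both
      sides vanish.\<close>
    case True
    then show ?thesis
      by (auto simp: wt_kernel_def case_prod_beta x fbm_weight_def)
  next
    case False
    let ?n = "(cmod (exp (\<i> * complex_of_real (x1 * fst \<xi>)) - 1))\<^sup>2 *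
      (cmod (exp (\<i> * complex_of_real (x2 * snd \<xi>)) - 1))\<^sup>2"
    let ?d = "\<bar>fst \<xi>\<bar> powr (H + 1/2) * \<bar>snd \<xi>\<bar> powr (H + 1/2)"
    have d: "0 < ?d" "?d \<le> wt_phi \<alpha> H \<xi>"
      using False assms wt_phi_ge_tensor[of \<alpha> H "fst \<xi>" "snd \<xi>"] by auto
    have "(cmod (wt_kernel \<alpha> H x \<xi>))\<^sup>2 = ?n / (wt_phi \<alpha> H \<xi>)\<^sup>2"
      by (simp add: wt_kernel_def case_prod_beta x norm_divide norm_mult power_mult_distrib power_divide)
    also have "\<dots> \<le> ?n / ?d\<^sup>2"
      using d by (intro divide_left_mono power_mono mult_pos_pos zero_less_power) auto
    also have "?d\<^sup>2 = \<bar>fst \<xi>\<bar> powr (2 * H + 1) * \<bar>snd \<xi>\<bar> powr (2 * H + 1)"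
      by (simp add: power_mult_distrib power2_eq_square algebra_simps flip: powr_add)
    finally show ?thesis
      by (simp add: fbm_weight_def)
  qed
  then have "integrable lborel (\<lambda>\<xi>. (cmod (wt_kernel \<alpha> H x \<xi>))\<^sup>2)"
    using assms
    by (intro Bochner_Integration.integrable_bound[OF integrable_lborel_tensor[OF
        fbm_weight_integrable[of H x1] fbm_weight_integrable[of H x2]]])
      (auto simp: fbm_weight_nonneg)
  then show ?thesis
    by (simp add: square_integrable_def)
qed

text \<open>The denominator is real and even, and conjugating the exponentials flips the sign of the
  frequencies.\<close>

lemma hermitian_wt_kernel: "hermitian (wt_kernel \<alpha> H x)"
  by (auto simp: hermitian_def wt_kernel_def wt_phi_def case_prod_beta exp_cnj)

text \<open>The numerator sees only the products of space and frequency coordinates, so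
  \<open>a\<close> can move from \<open>x\<close> to \<xi>; the homogeneity of \<open>wt_phi\<close>
  supplies the factor.\<close>

lemma wt_kernel_scaleR:
  assumes "0 < a"
  shows "wt_kernel \<alpha> H (a *\<^sub>R x) \<xi> = complex_of_real (a powr (2 * H + 1)) * wt_kernel \<alpha> H x (a *\<^sub>R \<xi>)"
proof -
  have "wt_phi \<alpha> H (a * fst \<xi>, a * snd \<xi>) = a powr (2 * H + 1) * wt_phi \<alpha> H \<xi>"
    using wt_phi_scaleR[OF assms, of \<alpha> H \<xi>] by (simp add: scaleR_prod_def)
  then show ?thesis
    using assms by (simp add: wt_kernel_def case_prod_beta mult_ac)
qed

section \<open>Self-similarity\<close>

theorem proposition3p1:
  fixes M :: "'w measure"
    and W :: "(real \<times> real \<Rightarrow> complex) \<Rightarrow> 'w \<Rightarrow> complex"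
    and \<alpha> H :: real
  assumes "fourier_white_noise M W"
    and "0 \<le> \<alpha>" "\<alpha> \<le> 1"
    and "0 < H" "H < 1"
  shows "\<forall>a>0. equal_fdd
           M (\<lambda>(x1, x2). weighted_tensorized_fbf W \<alpha> H (a * x1, a * x2))
           M (\<lambda>(x1, x2) \<omega>. a powr (2 * H) * weighted_tensorized_fbf W \<alpha> H (x1, x2) \<omega>)"
proof (intro allI impI)
  fix a :: real assume "0 < a"
  interpret fourier_white_noise M W by fact
  let ?K = "wt_kernel \<alpha> H"
  let ?X = "\<lambda>x \<omega>. Re (W (?K (a *\<^sub>R x)) \<omega>)" and ?Y = "\<lambda>x \<omega>. a powr (2 * H) * Re (W (?K x) \<omega>)"
  note K = square_integrable_wt_kernel[OF \<open>0 \<le> \<alpha>\<close> \<open>0 < H\<close> \<open>H < 1\<close>]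
  have meas: "?X x \<in> borel_measurable M" "?Y x \<in> borel_measurable M" for x
    using measurable_W[OF K, of "a *\<^sub>R x"] measurable_W[OF K, of x] by measurable
  \<comment> \<open>Almost sure linearity merges a combination of field values into one white noise
    integral. The map \<open>g\<close> is left general to serve both the dilated and the original
    points.\<close>
  have lincomb: "distr M borel (\<lambda>\<omega>. \<Sum>x\<in>J. t x * Re (W (?K (g x)) \<omega>)) =
      distr M borel (\<lambda>\<omega>. Re (W (\<lambda>\<xi>. \<Sum>x\<in>J. complex_of_real (t x) * ?K (g x) \<xi>) \<omega>))"
    if "finite J" for J t and g :: "real \<times> real \<Rightarrow> real \<times> real"
  proof (rule distr_cong_AE)
    have "AE \<omega> in M. W (\<lambda>\<xi>. \<Sum>x\<in>J. complex_of_real (t x) * ?K (g x) \<xi>) \<omega> =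
        (\<Sum>x\<in>J. complex_of_real (t x) * W (?K (g x)) \<omega>)"
      using that K by (rule W_lincomb)
    then show "AE \<omega> in M. (\<Sum>x\<in>J. t x * Re (W (?K (g x)) \<omega>)) =
        Re (W (\<lambda>\<xi>. \<Sum>x\<in>J. complex_of_real (t x) * ?K (g x) \<xi>) \<omega>)"
      by eventually_elim simp
    show "(\<lambda>\<omega>. \<Sum>x\<in>J. t x * Re (W (?K (g x)) \<omega>)) \<in> borel_measurable M"
      using measurable_W[OF K] by measurable
    show "(\<lambda>\<omega>. Re (W (\<lambda>\<xi>. \<Sum>x\<in>J. complex_of_real (t x) * ?K (g x) \<xi>) \<omega>)) \<in> borel_measurable M"
      using measurable_W[OF square_integrable_lincomb[OF K]] by measurable
  qed simp_all
  have lin: "distr M borel (\<lambda>\<omega>. \<Sum>x\<in>J. t x * ?X x \<omega>) = distr M borel (\<lambda>\<omega>. \<Sum>x\<in>J. t x * ?Y x \<omega>)"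
    if "finite J" for J t
  proof -
    \<comment> \<open>Both integrands are expressed through this one function: the left as a
      multiple of its dilation, the right as a multiple of itself.\<close>
    define F where "F \<xi> = (\<Sum>x\<in>J. complex_of_real (t x) * ?K x \<xi>)" for \<xi>
    have [measurable]: "F \<in> borel_measurable borel"
      unfolding F_def by measurable
    have left: "(\<Sum>x\<in>J. complex_of_real (t x) * ?K (a *\<^sub>R x) \<xi>) =
        complex_of_real (a powr (2 * H + 1)) * F (a *\<^sub>R \<xi>)" for \<xi>
      by (simp add: wt_kernel_scaleR[OF \<open>0 < a\<close>] F_def sum_distrib_left mult_ac)
    have right: "(\<Sum>x\<in>J. complex_of_real (t x * a powr (2 * H)) * ?K x \<xi>) =
        complex_of_real (a powr (2 * H)) * F \<xi>" for \<xi>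
      by (simp add: F_def sum_distrib_left mult_ac)
    have "(\<integral>\<xi>. (cmod (F (a *\<^sub>R \<xi>)))\<^sup>2 \<partial>lborel) = (\<integral>\<xi>. (cmod (F \<xi>))\<^sup>2 \<partial>lborel) / a\<^sup>2"
      using \<open>0 < a\<close> lborel_integral_scaleR[of a "\<lambda>\<xi>. (cmod (F \<xi>))\<^sup>2"]
      by (simp add: power2_eq_square)
    \<comment> \<open>The extra factor \<open>a\<close>, squared in the norm, cancels the
      \<open>1 / a\<^sup>2\<close> from the change of variables in the plane.\<close>
    moreover have "a powr (2 * H + 1) = a powr (2 * H) * a"
      using \<open>0 < a\<close> by (simp add: powr_add)
    ultimately have norm:
      "(\<integral>\<xi>. (cmod (\<Sum>x\<in>J. complex_of_real (t x) * ?K (a *\<^sub>R x) \<xi>))\<^sup>2 \<partial>lborel) =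
       (\<integral>\<xi>. (cmod (\<Sum>x\<in>J. complex_of_real (t x * a powr (2 * H)) * ?K x \<xi>))\<^sup>2 \<partial>lborel)"
      unfolding left right using \<open>0 < a\<close> by (simp add: norm_mult power_mult_distrib)
    have lin: "distr M borel (\<lambda>\<omega>. \<Sum>x\<in>J. t x * ?X x \<omega>) =
        distr M borel (\<lambda>\<omega>. Re (W (\<lambda>\<xi>. \<Sum>x\<in>J. complex_of_real (t x) * ?K (a *\<^sub>R x) \<xi>) \<omega>))"
      by (rule lincomb[OF that])
    also have "\<dots> = distr M borel
        (\<lambda>\<omega>. Re (W (\<lambda>\<xi>. \<Sum>x\<in>J. complex_of_real (t x * a powr (2 * H)) * ?K x \<xi>) \<omega>))"
      by (intro distr_Re_W_eqI square_integrable_lincomb hermitian_lincomb K hermitian_wt_kernel norm)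
    also have "\<dots> = distr M borel (\<lambda>\<omega>. \<Sum>x\<in>J. t x * ?Y x \<omega>)"
      using lincomb[OF that, of "\<lambda>x. t x * a powr (2 * H)" "\<lambda>x. x"] by (simp add: mult.assoc)
    finally show ?thesis .
  qed
  have "equal_fdd M ?X M ?Y"
    unfolding equal_fdd_def
    using meas cramer_wold[OF prob_space_axioms prob_space_axioms meas _ lin] by blast
  moreover have "(\<lambda>(x1, x2). weighted_tensorized_fbf W \<alpha> H (a * x1, a * x2)) = ?X"
    "(\<lambda>(x1, x2) \<omega>. a powr (2 * H) * weighted_tensorized_fbf W \<alpha> H (x1, x2) \<omega>) = ?Y"
    by (auto simp: weighted_tensorized_fbf_def fun_eq_iff)
  ultimately show "equal_fdd
           M (\<lambda>(x1, x2). weighted_tensorized_fbf W \<alpha> H (a * x1, a * x2))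
           M (\<lambda>(x1, x2) \<omega>. a powr (2 * H) * weighted_tensorized_fbf W \<alpha> H (x1, x2) \<omega>)"
    by simp
qed

end
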